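(* Let $p\in(0,\infty]$, $q\in(0,\infty]$ and let $b$ be a slowly varying function. Then $L^{(p,q,b)}=L^{p,q,b}$ (up to equivalence of the defining functionals) if and only if $p>1$.
   Context: $(R,\mu)$ is a $\sigma$-finite non-atomic measure space with $\mu(R)=\infty$; $M=M(R,\mu)$ is the set of extended complex-valued $\mu$-measurable functions on $R$ (identified when equal $\mu$-a.e.). For $f\in M$, $f^*(t)=\inf\{s\ge 0:\mu(\{|f|>s\})\le t\}$ and $f^{**}(t)=\frac1t\int_0^t f^*(s)\,ds$. Convention: $1/\infty=0$. A measurable $b:(0,\infty)\to(0,\infty)$ is slowly varying if for every $\varepsilon>0$ there are a non-decreasing function $b_\varepsilon$ and a non-increasing function $b_{-\varepsilon}$ with $t^\varepsilon b(t)\approx b_\varepsilon(t)$ and $t^{-\varepsilon}b(t)\approx b_{-\varepsilon}(t)$ on $(0,\infty)$, where $\approx$ denotes two-sided estimate up to positive finite multiplicative constants. For $f\in M$, $\lVert f\rVert_{p,q,b}=\lVert t^{1/p-1/q}b(t)f^*(t)\rVert_q$ and $\lVert f\rVert_{(p,q,b)}=\lVert t^{1/p-1/q}b(t)f^{**}(t)\rVert_q$, where $\lVert\cdot\rVert_q$ is the Lebesgue $L^q$ (quasi)norm over $(0,\infty)$ in the variable $t$; $L^{p,q,b}$ and $L^{(p,q,b)}$ are the sets of $f\in M$ for which the respective functional is finite. Equality of two such spaces up to equivalence of the defining functionals means that the sets coincide and the functionals are bounded by constant multiples of each other. *)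

theory Defs
  imports "HOL-Analysis.Analysis" "HOL-Probability.Essential_Supremum"
begin

definition nonatomic :: "'a measure \<Rightarrow> bool" where
  "nonatomic R \<longleftrightarrow>
     (\<forall>A\<in>sets R. 0 < emeasure R A \<longrightarrow>
        (\<exists>B\<in>sets R. B \<subseteq> A \<and> 0 < emeasure R B \<and> emeasure R B < emeasure R A))"

text \<open>Extended complex numbers: \<^term>\<open>None\<close> is the point at infinity of the one-point
  compactification, whose Borel sets are the sets with Borel trace on the plane.\<close>

type_synonym ext_complex = "complex option"

definition ext_complex_borel :: "ext_complex measure" where
  "ext_complex_borel = sigma UNIV {A. Some -` A \<in> sets borel}"

lemma sets_ext_complex_borel: "sets ext_complex_borel = {A. Some -` A \<in> sets borel}"
proof -
  have "sigma_algebra UNIV {A :: ext_complex set. Some -` A \<in> sets borel}"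
  proof (rule sigma_algebra.intro)
    show "algebra UNIV {A :: ext_complex set. Some -` A \<in> sets borel}"
      by (auto simp: algebra_iff_Un vimage_Compl simp flip: Compl_eq_Diff_UNIV)
    show "sigma_algebra_axioms {A :: ext_complex set. Some -` A \<in> sets borel}"
      by unfold_locales (auto simp: vimage_Union)
  qed
  then show ?thesis
    unfolding ext_complex_borel_def
    by (simp add: sigma_algebra.sigma_sets_eq)
qed

fun ext_norm :: "ext_complex \<Rightarrow> ennreal" where
  "ext_norm None = \<infinity>"
| "ext_norm (Some z) = ennreal (norm z)"

text \<open>Members of \<open>M(R,\<mu>)\<close> are represented by functions rather than by classes modulo
  almost everywhere equality; everything below depends on the class only.\<close>

abbreviation measurable_functions :: "'a measure \<Rightarrow> ('a \<Rightarrow> ext_complex) set" where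
  "measurable_functions R \<equiv> measurable R ext_complex_borel"

definition rearrangement :: "'a measure \<Rightarrow> ('a \<Rightarrow> ext_complex) \<Rightarrow> real \<Rightarrow> ennreal" where
  "rearrangement R f t =
     Inf {ennreal s | s. 0 \<le> s \<and> emeasure R {x \<in> space R. ennreal s < ext_norm (f x)} \<le> ennreal t}"

definition maximal_rearrangement :: "'a measure \<Rightarrow> ('a \<Rightarrow> ext_complex) \<Rightarrow> real \<Rightarrow> ennreal" where
  "maximal_rearrangement R f t =
     (\<integral>\<^sup>+ s. rearrangement R f s \<partial>(lebesgue_on {0<..<t})) / ennreal t"

definition approx_on_pos :: "(real \<Rightarrow> real) \<Rightarrow> (real \<Rightarrow> real) \<Rightarrow> bool" where
  "approx_on_pos g h \<longleftrightarrow> (\<exists>c>0. \<exists>C>0. \<forall>t>0. c * h t \<le> g t \<and> g t \<le> C * h t)"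

definition slowly_varying :: "(real \<Rightarrow> real) \<Rightarrow> bool" where
  "slowly_varying b \<longleftrightarrow>
     b \<in> borel_measurable (lebesgue_on {0<..}) \<and> (\<forall>t>0. 0 < b t) \<and>
     (\<forall>\<epsilon>>0.
        (\<exists>g. mono_on {0<..} g \<and> approx_on_pos (\<lambda>t. t powr \<epsilon> * b t) g) \<and>
        (\<exists>h. antimono_on {0<..} h \<and> approx_on_pos (\<lambda>t. t powr (- \<epsilon>) * b t) h))"

text \<open>Powers of extended nonnegative numbers, for positive exponents only.\<close>

definition ennreal_powr :: "ennreal \<Rightarrow> real \<Rightarrow> ennreal" where
  "ennreal_powr x a = (if x = \<infinity> then \<infinity> else ennreal (enn2real x powr a))"

definition Lq_norm :: "ennreal \<Rightarrow> (real \<Rightarrow> ennreal) \<Rightarrow> ennreal" where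
  "Lq_norm q g =
     (if q = \<infinity> then esssup (lebesgue_on {0<..}) g
      else ennreal_powr (\<integral>\<^sup>+ t. ennreal_powr (g t) (enn2real q) \<partial>(lebesgue_on {0<..}))
             (1 / enn2real q))"

text \<open>The convention \<open>1/\<infinity> = 0\<close> is that of \<^typ>\<open>ennreal\<close>; the exponent itself may be
  negative, hence real.\<close>

definition weight :: "ennreal \<Rightarrow> ennreal \<Rightarrow> (real \<Rightarrow> real) \<Rightarrow> real \<Rightarrow> ennreal" where
  "weight p q b t = ennreal (t powr (enn2real (1 / p) - enn2real (1 / q)) * b t)"

definition LK_norm ::
  "'a measure \<Rightarrow> ennreal \<Rightarrow> ennreal \<Rightarrow> (real \<Rightarrow> real) \<Rightarrow> ('a \<Rightarrow> ext_complex) \<Rightarrow> ennreal" where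
  "LK_norm R p q b f = Lq_norm q (\<lambda>t. weight p q b t * rearrangement R f t)"

definition LK_max_norm ::
  "'a measure \<Rightarrow> ennreal \<Rightarrow> ennreal \<Rightarrow> (real \<Rightarrow> real) \<Rightarrow> ('a \<Rightarrow> ext_complex) \<Rightarrow> ennreal" where
  "LK_max_norm R p q b f = Lq_norm q (\<lambda>t. weight p q b t * maximal_rearrangement R f t)"

definition finite_space ::
  "'a measure \<Rightarrow> (('a \<Rightarrow> ext_complex) \<Rightarrow> ennreal) \<Rightarrow> ('a \<Rightarrow> ext_complex) set" where
  "finite_space R N = {f \<in> measurable_functions R. N f < \<infinity>}"

definition LK_space ::
  "'a measure \<Rightarrow> ennreal \<Rightarrow> ennreal \<Rightarrow> (real \<Rightarrow> real) \<Rightarrow> ('a \<Rightarrow> ext_complex) set" where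
  "LK_space R p q b = finite_space R (LK_norm R p q b)"

definition LK_max_space ::
  "'a measure \<Rightarrow> ennreal \<Rightarrow> ennreal \<Rightarrow> (real \<Rightarrow> real) \<Rightarrow> ('a \<Rightarrow> ext_complex) set" where
  "LK_max_space R p q b = finite_space R (LK_max_norm R p q b)"

definition equivalent_on ::
  "'f set \<Rightarrow> ('f \<Rightarrow> ennreal) \<Rightarrow> ('f \<Rightarrow> ennreal) \<Rightarrow> bool" where
  "equivalent_on X N N' \<longleftrightarrow>
     (\<exists>C::real. 0 < C \<and> (\<forall>f\<in>X. N f \<le> ennreal C * N' f \<and> N' f \<le> ennreal C * N f))"

end

theory Submission
  imports Defs
begin

text \<open>Since \<open>f\<^sup>*\<close> is non-increasing, \<open>f\<^sup>*\<close> is dominated by \<open>f\<^sup>*\<^sup>*\<close>. For \<open>p > 1\<close>, dyadic decomposition of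
  \<open>(0, t)\<close> bounds \<open>f\<^sup>*\<^sup>*(t)\<close> by a multiple of the supremum over \<open>m\<close> of \<open>2\<^sup>-\<^sup>m\<^sup>\<alpha> f\<^sup>*(2\<^sup>-\<^sup>m t)\<close> for any
  \<open>\<alpha> < 1\<close>; if \<open>\<alpha> > 1/p\<close>, the norms of the dilates form a geometric series, because slow
  variation costs only \<open>2\<^sup>m\<^sup>\<epsilon>\<close>. For \<open>p \<le> 1\<close>, a function whose rearrangement is comparable to
  \<open>t powr (\<epsilon> - 1)\<close> on \<open>(0, 1)\<close> and vanishes on \<open>[1, \<infinity>)\<close> has a finite nonzero norm, which
  passing to \<open>f\<^sup>*\<^sup>*\<close> multiplies by at least \<open>1 / (2\<epsilon>)\<close>; letting \<open>\<epsilon> \<rightarrow> 0\<close> excludes equivalence.\<close>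

section \<open>Non-atomic measures\<close>

text \<open>Non-atomicity splits a set of positive finite measure into two pieces of positive
  measure, one of which has at most half the measure. Repeated halving gets below any
  \<open>e\<close>.\<close>

lemma nonatomic_small_subset:
  assumes R: "nonatomic R" and A: "A \<in> fmeasurable R" "0 < measure R A" and e: "0 < e"
  obtains B where "B \<in> fmeasurable R" "B \<subseteq> A" "0 < measure R B" "measure R B \<le> e"
proof -
  have *: "\<exists>B\<in>fmeasurable R. B \<subseteq> A \<and> 0 < measure R B \<and> measure R B \<le> measure R A / 2 ^ n" for n
  proof (induction n)
    case 0
    then show ?case using A by auto
  next
    case (Suc n)
    then obtain B where B: "B \<in> fmeasurable R" "B \<subseteq> A" "0 < measure R B"
        "measure R B \<le> measure R A / 2 ^ n"
      by blast
    from B have "0 < emeasure R B" "B \<in> sets R"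
      by (auto simp: emeasure_eq_measure2)
    then obtain D where D: "D \<in> sets R" "D \<subseteq> B" "0 < emeasure R D" "emeasure R D < emeasure R B"
      using R unfolding nonatomic_def by blast
    have Df: "D \<in> fmeasurable R" using D B fmeasurableI2 by blast
    have Dm: "0 < measure R D" "measure R D < measure R B"
      using D(3,4) Df B(1) by (auto simp: emeasure_eq_measure2 ennreal_less_iff)
    have diff: "measure R (B - D) = measure R B - measure R D"
      using measurable_measure_Diff[of B R D] B Df D by (simp add: fmeasurableD)
    have BDf: "B - D \<in> fmeasurable R" using B Df by blast
    show ?case
    proof (cases "measure R D \<le> measure R B / 2")
      case True
      then show ?thesis using B D Df Dm by (intro bexI[of _ D]) auto
    next
      case False
      then show ?thesis using B D BDf Dm diff by (intro bexI[of _ "B - D"]) auto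
    qed
  qed
  obtain n where "measure R A / e < 2 ^ n"
    using real_arch_pow[of 2 "measure R A / e"] by auto
  then have "measure R A / 2 ^ n \<le> e" using e by (simp add: field_simps)
  with *[of n] that show ?thesis by (meson order_trans)
qed

text \<open>Sierpinski's theorem, by a greedy construction: each step picks up at least half of what
  any admissible enlargement could still gain, so nothing can be gained in the limit.\<close>

lemma nonatomic_subset_of_measure:
  assumes R: "nonatomic R" and A: "A \<in> fmeasurable R" and r: "0 \<le> r" "r \<le> measure R A"
  obtains B where "B \<in> fmeasurable R" "B \<subseteq> A" "measure R B = r"
proof -
  define P where "P E \<longleftrightarrow> E \<in> fmeasurable R \<and> E \<subseteq> A \<and> measure R E \<le> r" for E
  have step: "\<exists>E'. P E' \<and> E \<subseteq> E' \<and>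
      (\<forall>F. P F \<and> E \<subseteq> F \<longrightarrow> measure R F - measure R E \<le> 2 * (measure R E' - measure R E))"
    if E: "P E" for E
  proof -
    define S where "S = {measure R F | F. P F \<and> E \<subseteq> F}"
    have bdd: "bdd_above S" unfolding S_def P_def by (rule bdd_aboveI[of _ r]) auto
    have S: "measure R E \<in> S" using E by (auto simp: S_def)
    have up: "x \<le> Sup S" if "x \<in> S" for x using bdd that cSup_upper by blast
    show ?thesis
    proof (cases "Sup S \<le> measure R E")
      case True
      \<comment> \<open>No admissible enlargement gains anything here, so \<open>E\<close> serves as
        its own successor.\<close>
      then show ?thesis using E up by (intro exI[of _ E]) (force simp: S_def)
    next
      case False
      \<comment> \<open>Beating the midpoint of \<open>measure R E\<close> and \<open>Sup S\<close>
        secures at least half of the largest possible gain, which is where the factor 2 comes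
        from.\<close>
      then have "(Sup S + measure R E) / 2 < Sup S" by simp
      then obtain x where x: "x \<in> S" "(Sup S + measure R E) / 2 < x"
        using less_cSup_iff[of S] S bdd by blast
      then obtain E' where E': "P E'" "E \<subseteq> E'" "x = measure R E'" by (auto simp: S_def)
      have "measure R F - measure R E \<le> 2 * (measure R E' - measure R E)" if "P F" "E \<subseteq> F" for F
      proof -
        have "measure R F \<in> S" using that by (auto simp: S_def)
        from up[OF this] x(2) E'(3) show ?thesis by simp
      qed
      with E' show ?thesis by blast
    qed
  qed
  obtain E where E: "P (E 0)" and E': "\<And>n. P (E n)" "\<And>n. E n \<subseteq> E (Suc n)"
    "\<And>n F. P F \<Longrightarrow> E n \<subseteq> F \<Longrightarrow>
        measure R F - measure R (E n) \<le> 2 * (measure R (E (Suc n)) - measure R (E n))"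
    using dependent_nat_choice[of "\<lambda>_. P" "\<lambda>_ E E'. E \<subseteq> E' \<and>
      (\<forall>F. P F \<and> E \<subseteq> F \<longrightarrow> measure R F - measure R E \<le> 2 * (measure R E' - measure R E))"]
      step r by (metis P_def empty_subsetI fmeasurable.empty_sets measure_empty)
  define U where "U = (\<Union>n. E n)"
  have Es: "E n \<in> sets R" "E n \<subseteq> A" "measure R (E n) \<le> r" for n
    using E'(1)[of n] by (auto simp: P_def)
  have U: "U \<in> fmeasurable R" "U \<subseteq> A"
    using Es A by (auto simp: U_def intro!: fmeasurableI2[OF A])
  have lim: "(\<lambda>n. measure R (E n)) \<longlonglongrightarrow> measure R U"
    unfolding U_def
  proof (rule Lim_measure_incseq)
    show "incseq E" using E'(2) by (rule incseq_SucI)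
    show "emeasure R (\<Union> (range E)) \<noteq> \<infinity>" using U(1) by (auto simp: U_def fmeasurable_def)
  qed (use Es in auto)
  have Ur: "measure R U \<le> r" by (rule LIMSEQ_le_const2[OF lim]) (use Es in auto)
  have "measure R U = r"
  \<comment> \<open>If \<open>U\<close> fell short of \<open>r\<close>, then \<open>A - U\<close>
    would contain a set \<open>D\<close> of positive measure that can be added to every
    \<open>E n\<close>. Each step would then gain at least half the measure of \<open>D\<close>,
    although the gains tend to 0.\<close>
  proof (rule ccontr)
    assume "measure R U \<noteq> r"
    then have less: "measure R U < r" using Ur by simp
    have AU: "A - U \<in> fmeasurable R" using A U by blast
    have "measure R (A - U) = measure R A - measure R U"
      using measurable_measure_Diff[OF A _ U(2)] U(1) by (simp add: fmeasurableD)
    then have "0 < measure R (A - U)" using less r by simp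
    then obtain D where D: "D \<in> fmeasurable R" "D \<subseteq> A - U" "0 < measure R D"
        "measure R D \<le> r - measure R U"
      using nonatomic_small_subset[OF R AU, of "r - measure R U"] less by auto
    have gain: "measure R D \<le> 2 * (measure R (E (Suc n)) - measure R (E n))" for n
    proof -
      have En: "E n \<in> fmeasurable R" "E n \<subseteq> U" using E'(1) by (auto simp: P_def U_def)
      have "measure R (E n \<union> D) = measure R (E n) + measure R D"
      proof -
        have "E n \<inter> D = {}" using En D by blast
        with measure_Un3[OF En(1) D(1)] show ?thesis by simp
      qed
      moreover have "measure R (E n) \<le> measure R U"
        using En U by (intro measure_mono_fmeasurable) auto
      ultimately have "P (E n \<union> D)"
        using En D U unfolding P_def by auto
      from E'(3)[OF this, of n] show ?thesis
        using \<open>measure R (E n \<union> D) = _\<close> by (simp add: Un_upper1)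
    qed
    have "(\<lambda>n. 2 * (measure R (E (Suc n)) - measure R (E n))) \<longlonglongrightarrow> 2 * (measure R U - measure R U)"
      by (intro tendsto_intros lim LIMSEQ_Suc)
    then have "measure R D \<le> 2 * (measure R U - measure R U)"
      by (rule LIMSEQ_le_const) (use gain in auto)
    with D show False by simp
  qed
  with U that show ?thesis by blast
qed

text \<open>Sigma-finiteness and infinite total measure supply a set of finite measure above 1; a
  part of measure 1 is then halved forever. The empty intersection will make the level index in
  \<open>ex_dyadic_rearrangement\<close> well defined at every point.\<close>

lemma nonatomic_dyadic_chain:
  assumes sf: "sigma_finite_measure R" and R: "nonatomic R"
    and inf: "emeasure R (space R) = \<infinity>"
  obtains A :: "nat \<Rightarrow> 'a set" where "\<And>k. A k \<in> sets R" "decseq A" "(\<Inter>k. A k) = {}"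
    "\<And>k. emeasure R (A k) = ennreal ((1 / 2) ^ k)"
proof -
  obtain S :: "nat \<Rightarrow> 'a set" where S: "range S \<subseteq> sets R" "(\<Union>i. S i) = space R"
      "\<And>i. emeasure R (S i) \<noteq> \<infinity>" "incseq S"
    using sigma_finite_measure.sigma_finite_incseq[OF sf] by metis
  have "(SUP i. emeasure R (S i)) = \<infinity>"
    using SUP_emeasure_incseq[OF S(1,4)] S(2) inf by simp
  then obtain i where i: "1 < emeasure R (S i)"
    using less_SUP_iff[of 1 "\<lambda>i. emeasure R (S i)" UNIV] by (metis UNIV_I infinity_ennreal_def ennreal_one_less_top)
  have Sf: "S i \<in> fmeasurable R"
    using S(1) S(3)[of i] by (auto simp: fmeasurable_def less_top)
  then have "1 \<le> measure R (S i)"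
    using i by (simp add: emeasure_eq_measure2)
  then obtain A0 where A0: "A0 \<in> fmeasurable R" "measure R A0 = 1"
    using nonatomic_subset_of_measure[OF R Sf, of 1] by auto
  define Q where "Q k E \<longleftrightarrow> E \<in> fmeasurable R \<and> measure R E = (1 / 2) ^ k" for k :: nat and E
  have "\<exists>A. \<forall>k. Q k (A k) \<and> A (Suc k) \<subseteq> A k"
  proof (rule dependent_nat_choice[of Q "\<lambda>_ E E'. E' \<subseteq> E"])
    show "\<exists>E. Q 0 E" using A0 by (auto simp: Q_def)
    fix E k assume "Q k E"
    then obtain B where "B \<in> fmeasurable R" "B \<subseteq> E" "measure R B = (1 / 2) ^ Suc k"
      using nonatomic_subset_of_measure[OF R, of E "(1 / 2) ^ Suc k"] by (auto simp: Q_def)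
    then show "\<exists>E'. Q (Suc k) E' \<and> E' \<subseteq> E" by (auto simp: Q_def)
  qed
  then obtain A where A: "\<And>k. Q k (A k)" "\<And>k. A (Suc k) \<subseteq> A k" by blast
  have As: "A k \<in> sets R" and Am: "emeasure R (A k) = ennreal ((1 / 2) ^ k)" for k
    using A(1)[of k] by (auto simp: Q_def emeasure_eq_measure2)
  \<comment> \<open>The intersection lies in sets of arbitrarily small measure, so it is null and
    can be removed from every \<open>A k\<close> without changing measures.\<close>
  define N where "N = (\<Inter>k. A k)"
  have "emeasure R N \<le> ennreal ((1 / 2) ^ k)" for k
    unfolding Am[symmetric] using As by (intro emeasure_mono) (auto simp: N_def)
  moreover have "(\<lambda>k. ennreal ((1 / 2) ^ k)) \<longlonglongrightarrow> ennreal 0"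
    by (intro tendsto_ennrealI LIMSEQ_power_zero) simp
  ultimately have "emeasure R N \<le> ennreal 0"
    by (intro LIMSEQ_le_const) auto
  then have N: "N \<in> null_sets R" using As by (auto simp: N_def null_sets_def)
  show ?thesis
  proof
    show "A k - N \<in> sets R" for k using As N by auto
    show "decseq (\<lambda>k. A k - N)" using A(2) by (auto intro!: decseq_SucI)
    show "(\<Inter>k. A k - N) = {}" by (auto simp: N_def)
    show "emeasure R (A k - N) = ennreal ((1 / 2) ^ k)" for k
      using As N Am by (simp add: emeasure_Diff_null_set)
  qed
qed

text \<open>The function equals \<open>c ^ k\<close> on \<open>A k - A (Suc k)\<close> and 0 off
  \<open>A 0\<close>, so the sets where it exceeds a level are members of the chain. With
  \<open>c = 2 powr (1 - \<epsilon>)\<close> the rearrangement will follow the power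
  \<open>t powr (\<epsilon> - 1)\<close>.\<close>

lemma ex_dyadic_rearrangement:
  assumes "sigma_finite_measure R" and "nonatomic R"
    and "emeasure R (space R) = \<infinity>" and c: "1 < c"
  obtains f where "f \<in> measurable_functions R" "\<And>t. 1 \<le> t \<Longrightarrow> rearrangement R f t = 0"
    "\<And>k t. (1 / 2) ^ Suc k \<le> t \<Longrightarrow> t < (1 / 2) ^ k \<Longrightarrow> rearrangement R f t = ennreal (c ^ k)"
proof -
  obtain A :: "nat \<Rightarrow> 'a set" where As[measurable]: "\<And>k. A k \<in> sets R" and dec: "decseq A"
    and emp: "(\<Inter>k. A k) = {}" and Am: "\<And>k. emeasure R (A k) = ennreal ((1 / 2) ^ k)"
    using nonatomic_dyadic_chain[OF assms(1-3)] by metis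
  \<comment> \<open>On \<open>A 0\<close> this is the index of the last chain member containing
    \<open>x\<close>; it exists because the chain has empty intersection.\<close>
  define L where "L x = (LEAST k. x \<notin> A (Suc k))" for x
  define g where "g x = (if x \<in> A 0 then c ^ L x else 0)" for x
  define f where "f x = Some (complex_of_real (g x))" for x
  have L: "x \<in> A j \<longleftrightarrow> j \<le> L x" if "x \<in> A 0" for x j
  proof -
    have "\<exists>k. x \<notin> A (Suc k)"
    proof -
      from emp obtain k where "x \<notin> A k" by blast
      then show ?thesis using that by (cases k) auto
    qed
    then have out: "x \<notin> A (Suc (L x))" unfolding L_def by (rule LeastI_ex)
    have "x \<in> A (L x)"
    proof (cases "L x")
      case 0
      then show ?thesis using that by simp
    next
      case (Suc k)
      then have "k < L x" by simp
      then have "x \<in> A (Suc k)" unfolding L_def using not_less_Least by blast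
      then show ?thesis using Suc by simp
    qed
    with out show ?thesis using dec unfolding decseq_def
      by (metis not_less_eq_eq subsetD)
  qed
  have fm: "f \<in> measurable_functions R"
  proof -
    have [measurable]: "g \<in> borel_measurable R"
      unfolding g_def L_def by measurable
    have "(\<lambda>x. complex_of_real (g x)) \<in> borel_measurable R" by measurable
    moreover have "Some \<in> measurable borel ext_complex_borel"
    proof (rule measurableI)
      show "Some x \<in> space ext_complex_borel" for x :: complex
        by (simp add: ext_complex_borel_def space_measure_of_conv)
    qed (simp add: sets_ext_complex_borel)
    ultimately show ?thesis unfolding f_def by (rule measurable_compose)
  qed
  have ext: "ext_norm (f x) = ennreal (g x)" for x using c by (simp add: f_def g_def)
  have sub: "A k \<subseteq> space R" for k using sets.sets_into_space[OF As] .
  have A0: "x \<in> A 0" if "x \<in> A k" for x k using dec that by (auto simp: decseq_def)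
  \<comment> \<open>The comparison is strict, so points with value exactly \<open>c ^ k\<close> drop
    out and the index shifts to \<open>Suc k\<close>.\<close>
  have lev: "{x \<in> space R. ennreal (c ^ k) < ext_norm (f x)} = A (Suc k)" for k
  proof -
    have "ennreal (c ^ k) < ext_norm (f x) \<longleftrightarrow> x \<in> A (Suc k)" for x
    proof (cases "x \<in> A 0")
      case True
      have "ennreal (c ^ k) < ennreal (c ^ L x) \<longleftrightarrow> k < L x"
        using c by (simp add: ennreal_less_iff)
      then show ?thesis unfolding ext L[OF True] g_def using True by auto
    next
      case False
      then show ?thesis using A0 by (auto simp: ext g_def)
    qed
    then show ?thesis using sub by blast
  qed
  have lev_sup: "A k \<subseteq> {x \<in> space R. ennreal s < ext_norm (f x)}" if "s < c ^ k" "0 \<le> s" for s k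
  proof (rule subsetI)
    fix x assume x: "x \<in> A k"
    then have "k \<le> L x" using A0 L by blast
    then have "c ^ k \<le> c ^ L x" using c by (simp add: power_increasing)
    then have "s < c ^ L x" using that by simp
    then show "x \<in> {x \<in> space R. ennreal s < ext_norm (f x)}"
      using sub x A0[OF x] that by (auto simp: ext g_def ennreal_less_iff)
  qed
  have fmeas: "{x \<in> space R. ennreal s < ext_norm (f x)} \<in> sets R" for s
  proof -
    have [measurable]: "g \<in> borel_measurable R"
      unfolding g_def L_def by measurable
    show ?thesis unfolding ext by measurable
  qed
  show ?thesis
  proof
    show "f \<in> measurable_functions R" by (rule fm)
  next
    fix t :: real assume t: "1 \<le> t"
    have "emeasure R {x \<in> space R. ennreal 0 < ext_norm (f x)} \<le> emeasure R (A 0)"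
      by (intro emeasure_mono) (auto simp: ext g_def split: if_splits)
    also have "\<dots> \<le> ennreal t" using t by (simp add: Am)
    finally have "rearrangement R f t \<le> ennreal 0"
      unfolding rearrangement_def by (intro Inf_lower) blast
    then show "rearrangement R f t = 0" by simp
  next
    fix k and t :: real assume t: "(1 / 2) ^ Suc k \<le> t" "t < (1 / 2) ^ k"
    show "rearrangement R f t = ennreal (c ^ k)"
    proof (rule antisym)
      have "emeasure R {x \<in> space R. ennreal (c ^ k) < ext_norm (f x)} \<le> ennreal t"
        unfolding lev Am using t by (intro ennreal_leI)
      moreover have "0 \<le> c ^ k" using c by simp
      ultimately show "rearrangement R f t \<le> ennreal (c ^ k)"
        unfolding rearrangement_def by (intro Inf_lower) blast
    next
      show "ennreal (c ^ k) \<le> rearrangement R f t"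
        unfolding rearrangement_def
      proof (rule Inf_greatest, clarify)
        fix s :: real
        assume s: "0 \<le> s" "emeasure R {x \<in> space R. ennreal s < ext_norm (f x)} \<le> ennreal t"
        show "ennreal (c ^ k) \<le> ennreal s"
        \<comment> \<open>A level below \<open>c ^ k\<close> is exceeded on all of
          \<open>A k\<close>, whose measure \<open>(1 / 2) ^ k\<close> is larger than
          \<open>t\<close>.\<close>
        proof (rule ccontr)
          assume "\<not> ?thesis"
          then have "s < c ^ k" by (meson ennreal_leI not_le)
          then have "emeasure R (A k) \<le> emeasure R {x \<in> space R. ennreal s < ext_norm (f x)}"
            using s(1) by (intro emeasure_mono lev_sup fmeas)
          then have "ennreal ((1 / 2) ^ k) \<le> ennreal t" using s(2) Am by simp
          moreover have "0 < t" using t(1) by (rule less_le_trans[rotated]) simp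
          ultimately have "(1 / 2) ^ k \<le> t" by (subst (asm) ennreal_le_iff) auto
          with t(2) show False by simp
        qed
      qed
    qed
  qed
qed

section \<open>Rearrangements and slowly varying weights\<close>

text \<open>Writing the exponent as \<open>\<gamma> - 1\<close> turns integrability at 0 into
  \<open>0 < \<gamma>\<close>. The formula serves both the averages of rearrangements and the
  finiteness of norms.\<close>

lemma nn_integral_powr_Ioo:
  assumes "0 < \<gamma>" "0 < t"
  shows "(\<integral>\<^sup>+ s. ennreal (s powr (\<gamma> - 1)) \<partial>(lebesgue_on {0<..<t})) = ennreal (t powr \<gamma> / \<gamma>)"
proof -
  have "((\<lambda>s. s powr (\<gamma> - 1)) has_integral (t powr \<gamma> / \<gamma>)) {0<..<t}"
    using has_integral_powr_from_0[of "\<gamma> - 1" t] assms by (simp add: has_integral_Icc_iff_Ioo)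
  from nn_integral_has_integral_lebesgue'[OF _ this] show ?thesis
    by (simp add: nn_integral_restrict_space nn_integral_completion)
qed

lemma slowly_varying_measurable:
  "slowly_varying b \<Longrightarrow> b \<in> borel_measurable (lebesgue_on {0<..})"
  by (simp add: slowly_varying_def)

lemma slowly_varying_pos: "slowly_varying b \<Longrightarrow> 0 < t \<Longrightarrow> 0 < b t"
  by (simp add: slowly_varying_def)

text \<open>The non-increasing equivalent of \<open>t powr (- \<epsilon>) * b t\<close> is compared
  at \<open>u\<close> and \<open>l * u\<close>. The constant is the ratio of the two equivalence
  constants, hence uniform in \<open>l\<close> and \<open>u\<close>.\<close>

lemma slowly_varying_dilation:
  assumes b: "slowly_varying b" and e: "0 < \<epsilon>"
  obtains K where "0 < K" "\<And>l u. 1 \<le> l \<Longrightarrow> 0 < u \<Longrightarrow> b (l * u) \<le> K * l powr \<epsilon> * b u"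
proof -
  obtain h c C where h: "antimono_on {0<..} h" and c: "0 < c" "0 < C"
    and ch: "\<And>t. 0 < t \<Longrightarrow> c * h t \<le> t powr (- \<epsilon>) * b t \<and> t powr (- \<epsilon>) * b t \<le> C * h t"
    using b e unfolding slowly_varying_def approx_on_pos_def by metis
  show ?thesis
  proof
    show "0 < C / c" using c by simp
    fix l u :: real assume l: "1 \<le> l" and u: "0 < u"
    have lu: "0 < l * u" "u \<le> l * u" using l u by auto
    have "(l * u) powr (- \<epsilon>) * b (l * u) \<le> C * h (l * u)" using ch lu by blast
    also have "\<dots> \<le> C * h u"
      using h lu u c by (intro mult_left_mono) (auto simp: monotone_on_def)
    also have "\<dots> = C / c * (c * h u)" using c by simp
    also have "\<dots> \<le> C / c * (u powr (- \<epsilon>) * b u)"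
      using ch[OF u] c by (intro mult_left_mono) auto
    finally have *: "(l * u) powr (- \<epsilon>) * b (l * u) \<le> C / c * (u powr (- \<epsilon>) * b u)" .
    have "b (l * u) = (l * u) powr \<epsilon> * ((l * u) powr (- \<epsilon>) * b (l * u))"
      using l u by (simp add: powr_minus)
    also have "\<dots> \<le> (l * u) powr \<epsilon> * (C / c * (u powr (- \<epsilon>) * b u))"
      using * by (intro mult_left_mono) auto
    also have "\<dots> = C / c * l powr \<epsilon> * b u"
      using l u by (simp add: powr_mult powr_minus field_simps)
    finally show "b (l * u) \<le> C / c * l powr \<epsilon> * b u" .
  qed
qed

text \<open>Here the non-decreasing equivalent is used: its value at 1 dominates its values on
  \<open>(0, 1)\<close>.\<close>

lemma slowly_varying_bounded_near_0:
  assumes b: "slowly_varying b" and e: "0 < \<epsilon>"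
  obtains K where "0 < K" "\<And>t. 0 < t \<Longrightarrow> t < 1 \<Longrightarrow> t powr \<epsilon> * b t \<le> K"
proof -
  obtain g c C where g: "mono_on {0<..} g" and c: "0 < c" "0 < C"
    and ch: "\<And>t. 0 < t \<Longrightarrow> c * g t \<le> t powr \<epsilon> * b t \<and> t powr \<epsilon> * b t \<le> C * g t"
    using b e unfolding slowly_varying_def approx_on_pos_def by metis
  show ?thesis
  proof
    have "0 < b 1" using b slowly_varying_pos by simp
    then have "0 < C * g 1" using ch[of 1] by simp
    then show "0 < C * g 1" .
    fix t :: real assume t: "0 < t" "t < 1"
    have "t powr \<epsilon> * b t \<le> C * g t" using ch t by blast
    also have "\<dots> \<le> C * g 1" using g t c by (intro mult_left_mono) (auto simp: monotone_on_def)
    finally show "t powr \<epsilon> * b t \<le> C * g 1" .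
  qed
qed

section \<open>Monotonicity and measurability of rearrangements and their averages\<close>

lemma borel_measurable_mono_ennreal:
  fixes \<phi> :: "real \<Rightarrow> ennreal"
  assumes "mono \<phi>"
  shows "\<phi> \<in> borel_measurable borel"
proof (rule borel_measurableI_ge)
  fix y
  have "is_interval {x \<in> space borel. y \<le> \<phi> x}"
    unfolding is_interval_1 using assms by (auto simp: mono_def intro: order_trans)
  then show "{x \<in> space borel. y \<le> \<phi> x} \<in> sets borel"
    by (rule real_interval_borel_measurable)
qed

lemma borel_measurable_antimono_ennreal:
  fixes \<phi> :: "real \<Rightarrow> ennreal"
  assumes "antimono \<phi>"
  shows "\<phi> \<in> borel_measurable borel"
proof (rule borel_measurableI_ge)
  fix y
  have "is_interval {x \<in> space borel. y \<le> \<phi> x}"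
    unfolding is_interval_1 using assms by (auto simp: antimono_def intro: order_trans)
  then show "{x \<in> space borel. y \<le> \<phi> x} \<in> sets borel"
    by (rule real_interval_borel_measurable)
qed

lemma borel_imp_lebesgue_on:
  "f \<in> borel_measurable borel \<Longrightarrow> f \<in> borel_measurable (lebesgue_on S)"
  by (simp add: measurable_completion measurable_restrict_space1)

text \<open>A larger \<open>t\<close> admits more levels into the infimum. This holds on the whole
  line, since \<open>ennreal\<close> sends negative \<open>t\<close> to 0.\<close>

lemma antimono_rearrangement: "antimono (rearrangement R f)"
  unfolding rearrangement_def
  by (intro antimonoI Inf_superset_mono) (blast intro: order_trans ennreal_leI)

text \<open>The integral grows with its interval, so it is a monotone and hence Borel function of
  \<open>t\<close>.\<close>

lemma maximal_rearrangement_measurable: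
  "maximal_rearrangement R f \<in> borel_measurable (lebesgue_on S)"
proof -
  have "mono (\<lambda>t. \<integral>\<^sup>+ s. rearrangement R f s \<partial>(lebesgue_on {0<..<t}))"
    by (auto intro!: monoI nn_integral_mono simp: nn_integral_restrict_space split: split_indicator)
  then have "(\<lambda>t. \<integral>\<^sup>+ s. rearrangement R f s \<partial>(lebesgue_on {0<..<t})) \<in> borel_measurable borel"
    by (rule borel_measurable_mono_ennreal)
  then have "maximal_rearrangement R f \<in> borel_measurable borel"
    unfolding maximal_rearrangement_def by measurable
  then show ?thesis by (rule borel_imp_lebesgue_on)
qed

lemma rearrangement_le_maximal:
  assumes "0 < t"
  shows "rearrangement R f t \<le> maximal_rearrangement R f t"
proof -
  have "rearrangement R f t * ennreal t = (\<integral>\<^sup>+ s. rearrangement R f t \<partial>(lebesgue_on {0<..<t}))"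
    using assms by (simp add: emeasure_restrict_space space_restrict_space)
  also have "\<dots> \<le> (\<integral>\<^sup>+ s. rearrangement R f s \<partial>(lebesgue_on {0<..<t}))"
    using antimono_rearrangement[of R f]
    by (intro nn_integral_mono) (auto simp: antimono_def space_restrict_space)
  finally have "rearrangement R f t * ennreal t / ennreal t \<le> maximal_rearrangement R f t"
    unfolding maximal_rearrangement_def by (rule divide_right_mono_ennreal)
  then show ?thesis using assms by (simp add: ennreal_mult_divide_eq)
qed

section \<open>Dyadic bounds for averages\<close>

lemma ex_dyadic_bracket:
  fixes s t :: real
  assumes "0 < s" "s < t"
  obtains k where "t * (1 / 2) ^ Suc k \<le> s" "s < t * (1 / 2) ^ k"
proof -
  obtain n where "(1 / 2) ^ n < s / t"
    using real_arch_pow_inv[of "s / t" "1 / 2"] assms by auto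
  then have "t * (1 / 2) ^ n \<le> t * (s / t)"
    using assms by (intro mult_left_mono) auto
  then have ex: "\<exists>m. t * (1 / 2) ^ m \<le> s"
    using assms by auto
  \<comment> \<open>The least such \<open>m\<close> is not 0 because \<open>s < t\<close>; its
    predecessor is the bracketing index.\<close>
  define m where "m = (LEAST m. t * (1 / 2) ^ m \<le> s)"
  have m: "t * (1 / 2) ^ m \<le> s" unfolding m_def using ex by (rule LeastI_ex)
  then obtain k where k: "m = Suc k" using assms by (cases m) auto
  then have "k < m" by simp
  then have "\<not> t * (1 / 2) ^ k \<le> s" unfolding m_def by (rule not_less_Least)
  with m k that show ?thesis by simp
qed

text \<open>Dyadic bracketing bounds \<open>\<phi> s\<close> by
  \<open>(2 * t / s) powr \<alpha>\<close> times the supremum, and this power of \<open>s\<close> is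
  integrable at 0 because \<open>\<alpha> < 1\<close>. Integration produces the constant.\<close>

lemma average_le_dyadic_SUP:
  fixes \<phi> :: "real \<Rightarrow> ennreal"
  assumes \<phi>: "antimono \<phi>" and \<alpha>: "0 \<le> \<alpha>" "\<alpha> < 1" and t: "0 < t"
  shows "(\<integral>\<^sup>+ s. \<phi> s \<partial>(lebesgue_on {0<..<t})) / ennreal t \<le>
    ennreal (2 powr \<alpha> / (1 - \<alpha>)) * (SUP m::nat. ennreal (((1 / 2) ^ m) powr \<alpha>) * \<phi> (t * (1 / 2) ^ m))"
    (is "_ \<le> _ * ?S")
proof -
  have le: "\<phi> s \<le> ennreal (s powr ((1 - \<alpha>) - 1)) * (ennreal ((2 * t) powr \<alpha>) * ?S)" if s: "0 < s" "s < t" for s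
  proof -
    obtain k where k: "t * (1 / 2) ^ Suc k \<le> s" "s < t * (1 / 2) ^ k"
      using ex_dyadic_bracket[OF s] .
    \<comment> \<open>The lower end \<open>t * d\<close> of the dyadic interval is used because
      \<open>\<phi>\<close> is non-increasing; the upper end then gives
      \<open>1 / d < 2 * t / s\<close>, which trades \<open>d\<close> for \<open>s\<close>.\<close>
    define d where "d = (1 / 2 :: real) ^ Suc k"
    have d: "0 < d" "t * d \<le> s" "s < 2 * t * d" using k by (auto simp: d_def)
    have "\<phi> s \<le> \<phi> (t * d)" using \<phi> d by (auto simp: antimono_def)
    also have "\<dots> = ennreal (d powr (- \<alpha>)) * (ennreal (d powr \<alpha>) * \<phi> (t * d))"
      using d by (simp add: mult.assoc[symmetric] ennreal_mult[symmetric] powr_minus)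
    also have "\<dots> \<le> ennreal (d powr (- \<alpha>)) * ?S"
      unfolding d_def by (intro mult_left_mono SUP_upper) auto
    also have "\<dots> \<le> ennreal (((2 * t) / s) powr \<alpha>) * ?S"
    proof -
      have "d powr (- \<alpha>) = (1 / d) powr \<alpha>" using d by (simp add: powr_minus powr_divide divide_simps)
      also have "\<dots> \<le> (2 * t / s) powr \<alpha>"
        using d s t \<alpha> by (intro powr_mono2) (auto simp: field_simps)
      finally show ?thesis by (intro mult_right_mono ennreal_leI) auto
    qed
    also have "((2 * t) / s) powr \<alpha> = s powr ((1 - \<alpha>) - 1) * (2 * t) powr \<alpha>"
      using s t by (simp add: powr_divide powr_minus divide_simps)
    finally show ?thesis by (subst mult.assoc[symmetric], subst ennreal_mult[symmetric]) auto
  qed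
  have "(\<integral>\<^sup>+ s. \<phi> s \<partial>(lebesgue_on {0<..<t})) \<le>
      (\<integral>\<^sup>+ s. ennreal (s powr ((1 - \<alpha>) - 1)) * (ennreal ((2 * t) powr \<alpha>) * ?S) \<partial>(lebesgue_on {0<..<t}))"
    using le by (intro nn_integral_mono) (auto simp: space_restrict_space)
  also have "\<dots> = ennreal (t powr (1 - \<alpha>) / (1 - \<alpha>)) * (ennreal ((2 * t) powr \<alpha>) * ?S)"
  proof -
    have "(\<lambda>s. ennreal (s powr ((1 - \<alpha>) - 1))) \<in> borel_measurable (lebesgue_on {0<..<t})"
      by (rule borel_imp_lebesgue_on) measurable
    then show ?thesis using nn_integral_powr_Ioo[of "1 - \<alpha>" t] \<alpha> t by (simp add: nn_integral_multc)
  qed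
  also have "\<dots> = ennreal (t powr (1 - \<alpha>) / (1 - \<alpha>) * (2 * t) powr \<alpha>) * ?S"
    using \<alpha> by (subst mult.assoc[symmetric], subst ennreal_mult[symmetric]) auto
  also have "t powr (1 - \<alpha>) / (1 - \<alpha>) * (2 * t) powr \<alpha> = 2 powr \<alpha> / (1 - \<alpha>) * t"
    using t by (simp add: powr_mult powr_diff)
  finally have "(\<integral>\<^sup>+ s. \<phi> s \<partial>(lebesgue_on {0<..<t})) / ennreal t \<le>
      ennreal (2 powr \<alpha> / (1 - \<alpha>) * t) * ?S / ennreal t"
    by (rule divide_right_mono_ennreal)
  \<comment> \<open>The finite nonzero factor \<open>ennreal t\<close> is moved last so that it
    cancels even if \<open>?S\<close> is infinite.\<close>
  also have "\<dots> = ennreal (2 powr \<alpha> / (1 - \<alpha>)) * ?S * ennreal t / ennreal t"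
    using \<alpha> t by (subst ennreal_mult) (auto simp: ac_simps)
  also have "\<dots> = ennreal (2 powr \<alpha> / (1 - \<alpha>)) * ?S"
    using t by (subst ennreal_mult_divide_eq) auto
  finally show ?thesis .
qed

section \<open>Powers of extended nonnegative numbers\<close>

lemma ennreal_powr_ennreal: "0 \<le> x \<Longrightarrow> ennreal_powr (ennreal x) a = ennreal (x powr a)"
  by (simp add: ennreal_powr_def)

lemma ennreal_powr_mono: "x \<le> y \<Longrightarrow> 0 \<le> a \<Longrightarrow> ennreal_powr x a \<le> ennreal_powr y a"
  unfolding ennreal_powr_def
  by (auto simp: top_unique enn2real_mono less_top intro!: ennreal_leI powr_mono2)

lemma ennreal_powr_eq_0_iff: "ennreal_powr x a = 0 \<longleftrightarrow> x = 0"
  by (cases x) (auto simp: ennreal_powr_def)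

lemma ennreal_powr_less_top: "x < top \<Longrightarrow> ennreal_powr x a < top"
  by (auto simp: ennreal_powr_def)

lemma ennreal_powr_mult:
  "ennreal_powr (x * y) a = ennreal_powr x a * ennreal_powr y a"
\<comment> \<open>Zero is treated apart because the product of 0 and infinity is 0; the convention
  \<open>0 powr a = 0\<close> agrees with this for every \<open>a\<close>.\<close>
proof (cases "x = 0 \<or> y = 0")
  case True
  then show ?thesis by (auto simp: ennreal_powr_def)
next
  case False
  then show ?thesis
    by (cases x; cases y)
      (auto simp: ennreal_powr_def ennreal_mult_top ennreal_top_mult enn2real_mult powr_mult ennreal_mult
        ennreal_mult_eq_top_iff)
qed

lemma ennreal_powr_powr: "ennreal_powr (ennreal_powr x a) c = ennreal_powr x (a * c)"
  by (cases x) (auto simp: ennreal_powr_def powr_powr)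

lemma ennreal_powr_1: "ennreal_powr x 1 = x"
  by (cases x) (auto simp: ennreal_powr_def)

lemma ennreal_powr_measurable[measurable]:
  assumes [measurable]: "f \<in> borel_measurable M"
  shows "(\<lambda>x. ennreal_powr (f x) a) \<in> borel_measurable M"
  unfolding ennreal_powr_def by measurable

text \<open>Each term is at most the sum, so each \<open>x m\<close> is at most the root of the sum.
  The supremum inherits this bound, and raising to the power \<open>a\<close> undoes the
  root.\<close>

lemma ennreal_powr_SUP_le_suminf:
  fixes x :: "nat \<Rightarrow> ennreal"
  assumes a: "0 < a"
  shows "ennreal_powr (SUP m. x m) a \<le> (\<Sum>m. ennreal_powr (x m) a)" (is "_ \<le> ?y")
proof -
  have "x m \<le> ennreal_powr ?y (1 / a)" for m
  proof -
    have "ennreal_powr (x m) a \<le> ?y"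
      using sum_le_suminf[of "\<lambda>m. ennreal_powr (x m) a" "{m}"] by simp
    then have "ennreal_powr (ennreal_powr (x m) a) (1 / a) \<le> ennreal_powr ?y (1 / a)"
      using a by (intro ennreal_powr_mono) auto
    then show ?thesis using a by (simp add: ennreal_powr_powr ennreal_powr_1)
  qed
  then have "(SUP m. x m) \<le> ennreal_powr ?y (1 / a)" by (intro SUP_least)
  then have "ennreal_powr (SUP m. x m) a \<le> ennreal_powr (ennreal_powr ?y (1 / a)) a"
    using a by (intro ennreal_powr_mono) auto
  then show ?thesis using a by (simp add: ennreal_powr_powr ennreal_powr_1)
qed

section \<open>Dilations of the half-line\<close>

lemma lebesgue_measurable_mult: "(\<lambda>t. d * t) \<in> lebesgue \<rightarrow>\<^sub>M lebesgue" for d :: real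
proof -
  have "(*\<^sub>R) d = (\<lambda>t. d * t)" by auto
  then show ?thesis using lebesgue_measurable_scaling[of d, where 'a = real] by simp
qed

lemma nn_integral_dilation:
  fixes G :: "real \<Rightarrow> ennreal"
  assumes G: "G \<in> borel_measurable (lebesgue_on {0<..})" and d: "0 < d"
  shows "(\<integral>\<^sup>+ t. ennreal d * G (t * d) \<partial>(lebesgue_on {0<..})) = (\<integral>\<^sup>+ t. G t \<partial>(lebesgue_on {0<..}))"
proof -
  \<comment> \<open>Extension by zero passes to the whole line, where the scaling law of Lebesgue
    measure applies; a positive dilation preserves the half-line.\<close>
  define F where "F t = G t * indicator {0<..} t" for t :: real
  have F: "F \<in> borel_measurable lebesgue"
    using G unfolding F_def by (subst (asm) borel_measurable_restrict_space_iff_ennreal) auto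
  note m = lebesgue_measurable_mult[of d]
  have "(\<integral>\<^sup>+ t. G t \<partial>(lebesgue_on {0<..})) = (\<integral>\<^sup>+ t. F t \<partial>lebesgue)"
    by (simp add: nn_integral_restrict_space F_def)
  also have "\<dots> = (\<integral>\<^sup>+ t. F t \<partial>density (distr lebesgue lebesgue (\<lambda>x. d * x)) (\<lambda>x. ennreal \<bar>d\<bar>))"
    using lebesgue_real_scale[of d] d by simp
  also have "\<dots> = (\<integral>\<^sup>+ t. ennreal d * F (d * t) \<partial>lebesgue)"
    using F m d by (subst nn_integral_density) (auto simp: nn_integral_distr)
  also have "\<dots> = (\<integral>\<^sup>+ t. ennreal d * G (t * d) \<partial>(lebesgue_on {0<..}))"
    using d by (auto simp: nn_integral_restrict_space F_def zero_less_mult_iff mult.commute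
        intro!: nn_integral_cong split: split_indicator)
  finally show ?thesis by simp
qed

lemma dilation_measurable:
  fixes d :: real
  assumes G: "G \<in> borel_measurable (lebesgue_on {0<..})" and d: "0 < d"
  shows "(\<lambda>t. G (t * d)) \<in> borel_measurable (lebesgue_on {0<..})"
proof -
  have "(\<lambda>t. t * d) \<in> lebesgue_on {0<..} \<rightarrow>\<^sub>M lebesgue_on {0<..}"
    using d lebesgue_measurable_mult[of d] by (intro measurable_restrict_space3) (auto simp: mult.commute)
  then show ?thesis using G by (rule measurable_compose)
qed

text \<open>By the scaling law, Lebesgue measure and its image under a dilation have the same null
  sets. This replaces the change of variables when \<open>q\<close> is infinite.\<close>

lemma AE_dilation:
  fixes d :: real
  assumes P: "AE t in lebesgue_on {0<..}. P t" and d: "0 < d"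
  shows "AE t in lebesgue_on {0<..}. P (t * d)"
proof -
  note m = lebesgue_measurable_mult[of d]
  have "AE t in lebesgue. t \<in> {0<..} \<longrightarrow> P t" using P by (simp add: AE_restrict_space_iff)
  then have "AE t in density (distr lebesgue lebesgue (\<lambda>x. d * x)) (\<lambda>x. ennreal \<bar>d\<bar>). t \<in> {0<..} \<longrightarrow> P t"
    by (subst lebesgue_real_scale[of d, symmetric]) (use d in auto)
  then have "AE t in distr lebesgue lebesgue (\<lambda>x. d * x). t \<in> {0<..} \<longrightarrow> P t"
    using d by (simp add: AE_density)
  from AE_distrD[OF m this] show ?thesis
    using d by (simp add: AE_restrict_space_iff zero_less_mult_iff mult.commute)
qed

section \<open>The two functionals\<close>

lemma Lq_exponent:
  assumes "0 < q" "q \<noteq> \<infinity>"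
  shows "0 < enn2real q" "enn2real (1 / q) = 1 / enn2real q"
proof -
  show pos: "0 < enn2real q" using assms by (simp add: enn2real_positive_iff less_top)
  obtain x where x: "q = ennreal x" "0 \<le> x" using assms by (cases q) auto
  with pos have "0 < x" by simp
  then have "1 / q = ennreal (1 / x)" using x divide_ennreal[of 1 x] by simp
  then show "enn2real (1 / q) = 1 / enn2real q" using x by simp
qed

section \<open>Monotonicity, scaling, positivity and finiteness of Lebesgue quasinorms\<close>

lemma Lq_norm_mono:
  assumes f: "f \<in> borel_measurable (lebesgue_on {0<..})" and le: "\<And>t. 0 < t \<Longrightarrow> f t \<le> g t"
  shows "Lq_norm q f \<le> Lq_norm q g"
proof -
  have "esssup (lebesgue_on {0<..}) f \<le> esssup (lebesgue_on {0<..}) g"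
    using le by (intro esssup_AE_mono f AE_I2) (simp add: space_restrict_space)
  moreover have "(\<integral>\<^sup>+ t. ennreal_powr (f t) (enn2real q) \<partial>(lebesgue_on {0<..}))
      \<le> (\<integral>\<^sup>+ t. ennreal_powr (g t) (enn2real q) \<partial>(lebesgue_on {0<..}))"
    using le by (intro nn_integral_mono ennreal_powr_mono) (auto simp: space_restrict_space)
  ultimately show ?thesis unfolding Lq_norm_def by (auto intro!: ennreal_powr_mono)
qed

text \<open>For infinite \<open>q\<close>, \<open>f\<close> is almost everywhere at most
  \<open>1 / c\<close> times the essential supremum of the multiple, hence so is its own essential
  supremum. For finite \<open>q\<close>, homogeneity gives equality.\<close>

lemma Lq_norm_cmult_ge:
  assumes f: "f \<in> borel_measurable (lebesgue_on {0<..})" and q: "0 < q" and c: "0 < c"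
  shows "ennreal c * Lq_norm q f \<le> Lq_norm q (\<lambda>t. ennreal c * f t)"
proof (cases "q = \<infinity>")
  case True
  let ?E = "esssup (lebesgue_on {0<..}) (\<lambda>t. ennreal c * f t)"
  have eq: "ennreal c * (ennreal (1 / c) * x) = x" for x
    using c by (simp add: mult.assoc[symmetric] ennreal_mult[symmetric])
  have "AE t in lebesgue_on {0<..}. f t \<le> ennreal (1 / c) * ?E"
    using esssup_AE[of "\<lambda>t. ennreal c * f t" "lebesgue_on {0<..}"]
  proof eventually_elim
    case (elim t)
    then have "ennreal c * f t \<le> ennreal c * (ennreal (1 / c) * ?E)" by (simp only: eq)
    then show ?case using c by (subst (asm) ennreal_mult_le_mult_iff) auto
  qed
  then have "esssup (lebesgue_on {0<..}) f \<le> ennreal (1 / c) * ?E"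
    by (intro esssup_I f)
  then have "ennreal c * esssup (lebesgue_on {0<..}) f \<le> ennreal c * (ennreal (1 / c) * ?E)"
    by (intro mult_left_mono) auto
  then show ?thesis using True by (simp add: Lq_norm_def eq)
next
  case False
  note Q = Lq_exponent(1)[OF q False]
  have "Lq_norm q (\<lambda>t. ennreal c * f t) = ennreal c * Lq_norm q f"
    using False c Q f
    by (simp add: Lq_norm_def ennreal_powr_mult nn_integral_cmult ennreal_powr_powr ennreal_powr_1)
  then show ?thesis by simp
qed

text \<open>Dilation by \<open>d\<close> scales the \<open>L\<^sup>q\<close> norm by \<open>d powr - (1/q)\<close>, so the weights
  \<open>d powr (\<epsilon> + 1/q)\<close> leave a convergent geometric series. Bounding a supremum of powers
  by their sum avoids Minkowski's inequality and works for \<open>q < 1\<close> as well.\<close>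

lemma Lq_norm_dyadic_SUP:
  assumes q: "0 < q" and e: "0 < \<epsilon>" and K: "0 < K"
  shows "\<exists>C>0. \<forall>G \<in> borel_measurable (lebesgue_on {0<..}). \<forall>H \<in> borel_measurable (lebesgue_on {0<..}).
      (\<forall>t>0. H t \<le> ennreal K *
        (SUP m::nat. ennreal (((1 / 2) ^ m) powr (\<epsilon> + enn2real (1 / q))) * G (t * (1 / 2) ^ m))) \<longrightarrow>
      Lq_norm q H \<le> ennreal C * Lq_norm q G"
proof (cases "q = \<infinity>")
  case True
  show ?thesis
  proof (intro exI[of _ K] conjI ballI impI K)
    fix G H :: "real \<Rightarrow> ennreal"
    assume H: "H \<in> borel_measurable (lebesgue_on {0<..})"
      and le: "\<forall>t>0. H t \<le> ennreal K *
        (SUP m::nat. ennreal (((1 / 2) ^ m) powr (\<epsilon> + enn2real (1 / q))) * G (t * (1 / 2) ^ m))"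
    let ?E = "esssup (lebesgue_on {0<..}) G"
    \<comment> \<open>There are countably many dilates, so one null set serves all
      \<open>m\<close>.\<close>
    have "AE t in lebesgue_on {0<..}. \<forall>m::nat. G (t * (1 / 2) ^ m) \<le> ?E"
      unfolding AE_all_countable by (intro allI AE_dilation esssup_AE) auto
    moreover have "AE t in lebesgue_on {0<..}. 0 < t"
      by (intro AE_I2) (simp add: space_restrict_space)
    ultimately have "AE t in lebesgue_on {0<..}. H t \<le> ennreal K * ?E"
    proof eventually_elim
      case (elim t)
      have "(SUP m::nat. ennreal (((1 / 2) ^ m) powr (\<epsilon> + enn2real (1 / q))) * G (t * (1 / 2) ^ m)) \<le> ?E"
      proof (rule SUP_least)
        fix m :: nat
        have "((1 / 2) ^ m) powr (\<epsilon> + enn2real (1 / q)) \<le> (1::real)"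
          using e by (intro powr_le1) (auto simp: power_le_one)
        then have "ennreal (((1 / 2) ^ m) powr (\<epsilon> + enn2real (1 / q))) * G (t * (1 / 2) ^ m) \<le> 1 * ?E"
          using elim by (intro mult_mono) (auto simp: ennreal_le_1)
        then show "ennreal (((1 / 2) ^ m) powr (\<epsilon> + enn2real (1 / q))) * G (t * (1 / 2) ^ m) \<le> ?E"
          by simp
      qed
      then show ?case using le elim(2) by (meson mult_left_mono order_trans zero_le)
    qed
    then show "Lq_norm q H \<le> ennreal K * Lq_norm q G"
      using True H by (auto simp: Lq_norm_def intro: esssup_I)
  qed
next
  case False
  define Q where "Q = enn2real q"
  have Q: "0 < Q" "enn2real (1 / q) = 1 / Q" using Lq_exponent[OF q False] by (auto simp: Q_def)
  \<comment> \<open>The \<open>Q\<close>-th power of the \<open>m\<close>-th weight is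
    \<open>x ^ m * (1 / 2) ^ m\<close>: a geometric term times the Jacobian of the dilation. Thus
    \<open>D\<close> below is \<open>K powr Q\<close> times the sum of the geometric series.\<close>
  define x where "x = (1 / 2) powr (\<epsilon> * Q)"
  have x: "0 < x" "x < 1" using e Q powr_less_mono'[of "1/2" 0 "\<epsilon> * Q"] by (auto simp: x_def)
  define D where "D = K powr Q * (1 / (1 - x))"
  have D: "0 < D" using x K by (simp add: D_def)
  show ?thesis
  proof (intro exI[of _ "D powr (1 / Q)"] conjI ballI impI)
    show "0 < D powr (1 / Q)" using D by simp
    fix G H :: "real \<Rightarrow> ennreal"
    assume G: "G \<in> borel_measurable (lebesgue_on {0<..})"
      and le: "\<forall>t>0. H t \<le> ennreal K *
        (SUP m::nat. ennreal (((1 / 2) ^ m) powr (\<epsilon> + enn2real (1 / q))) * G (t * (1 / 2) ^ m))"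
    let ?L = "lebesgue_on {0<..} :: real measure"
    let ?g = "\<lambda>m t. ennreal ((1 / 2) ^ m) * ennreal_powr (G (t * (1 / 2) ^ m)) Q"
    have pt: "ennreal_powr (H t) Q \<le> ennreal (K powr Q) * (\<Sum>m. ennreal (x ^ m) * ?g m t)"
      if t: "0 < t" for t
    proof -
      have term_eq: "ennreal_powr (ennreal (((1 / 2) ^ m) powr (\<epsilon> + enn2real (1 / q))) * G (t * (1 / 2) ^ m)) Q
          = ennreal (x ^ m) * ?g m t" for m :: nat
      proof -
        have "(((1 / 2) ^ m) powr (\<epsilon> + enn2real (1 / q))) powr Q = ((1 / 2) ^ m) powr (\<epsilon> * Q + 1)"
          using Q by (simp add: powr_powr algebra_simps)
        also have "\<dots> = x ^ m * (1 / 2) ^ m"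
        proof -
          have "((1 / 2) ^ m) powr (\<epsilon> * Q) = x ^ m"
            unfolding x_def by (simp add: powr_realpow[symmetric] powr_powr mult.commute)
          then show ?thesis by (simp add: powr_add)
        qed
        finally show ?thesis
          using x by (simp add: ennreal_powr_mult ennreal_powr_ennreal ennreal_mult mult.assoc)
      qed
      have "ennreal_powr (H t) Q \<le> ennreal_powr (ennreal K *
        (SUP m::nat. ennreal (((1 / 2) ^ m) powr (\<epsilon> + enn2real (1 / q))) * G (t * (1 / 2) ^ m))) Q"
        using le t Q by (intro ennreal_powr_mono) auto
      also have "\<dots> = ennreal (K powr Q) * ennreal_powr
        (SUP m::nat. ennreal (((1 / 2) ^ m) powr (\<epsilon> + enn2real (1 / q))) * G (t * (1 / 2) ^ m)) Q"
        using K by (simp add: ennreal_powr_mult ennreal_powr_ennreal)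
      also have "\<dots> \<le> ennreal (K powr Q) * (\<Sum>m. ennreal (x ^ m) * ?g m t)"
        using ennreal_powr_SUP_le_suminf[OF Q(1), of "\<lambda>m::nat. ennreal (((1 / 2) ^ m)
          powr (\<epsilon> + enn2real (1 / q))) * G (t * (1 / 2) ^ m)"]
        unfolding term_eq by (intro mult_left_mono) auto
      finally show ?thesis .
    qed
    have gm: "?g m \<in> borel_measurable ?L" for m
      using dilation_measurable[OF G, of "(1 / 2) ^ m"] by measurable
    \<comment> \<open>The factor \<open>(1 / 2) ^ m\<close> inside \<open>?g\<close> makes this
      integral independent of \<open>m\<close>.\<close>
    have int: "(\<integral>\<^sup>+ t. ?g m t \<partial>?L) = (\<integral>\<^sup>+ t. ennreal_powr (G t) Q \<partial>?L)" for m
      using nn_integral_dilation[of "\<lambda>t. ennreal_powr (G t) Q" "(1 / 2) ^ m"] G by simp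
    have "(\<integral>\<^sup>+ t. ennreal_powr (H t) Q \<partial>?L) \<le>
        (\<integral>\<^sup>+ t. ennreal (K powr Q) * (\<Sum>m. ennreal (x ^ m) * ?g m t) \<partial>?L)"
      using pt by (intro nn_integral_mono) (auto simp: space_restrict_space)
    also have "\<dots> = ennreal (K powr Q) * (\<Sum>m. ennreal (x ^ m) * (\<integral>\<^sup>+ t. ennreal_powr (G t) Q \<partial>?L))"
      using gm by (simp add: nn_integral_cmult nn_integral_suminf int)
    also have "\<dots> = ennreal (K powr Q) * (ennreal (1 / (1 - x)) * (\<integral>\<^sup>+ t. ennreal_powr (G t) Q \<partial>?L))"
    proof -
      have "(\<Sum>m. ennreal (x ^ m)) = ennreal (1 / (1 - x))"
        using x geometric_sums[of x] by (intro suminf_ennreal_eq) auto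
      then show ?thesis by simp
    qed
    also have "\<dots> = ennreal D * (\<integral>\<^sup>+ t. ennreal_powr (G t) Q \<partial>?L)"
      using x unfolding D_def by (subst mult.assoc[symmetric], subst ennreal_mult[symmetric]) auto
    finally have "ennreal_powr (\<integral>\<^sup>+ t. ennreal_powr (H t) Q \<partial>?L) (1 / Q) \<le>
        ennreal_powr (ennreal D * (\<integral>\<^sup>+ t. ennreal_powr (G t) Q \<partial>?L)) (1 / Q)"
      using Q by (intro ennreal_powr_mono) auto
    also have "\<dots> = ennreal (D powr (1 / Q)) * ennreal_powr (\<integral>\<^sup>+ t. ennreal_powr (G t) Q \<partial>?L) (1 / Q)"
      using D by (simp add: ennreal_powr_mult ennreal_powr_ennreal)
    finally show "Lq_norm q H \<le> ennreal (D powr (1 / Q)) * Lq_norm q G"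
      using False by (simp add: Lq_norm_def Q_def)
  qed
qed

text \<open>For finite and infinite \<open>q\<close> alike, a vanishing norm forces
  \<open>G = 0\<close> almost everywhere, which fails on \<open>(0, 1)\<close>.\<close>

lemma Lq_norm_pos:
  assumes G: "G \<in> borel_measurable (lebesgue_on {0<..})" and q: "0 < q"
    and pos: "\<And>t. 0 < t \<Longrightarrow> t < 1 \<Longrightarrow> 0 < G t"
  shows "0 < Lq_norm q G"
proof (rule ccontr)
  assume "\<not> 0 < Lq_norm q G"
  then have 0: "Lq_norm q G = 0" by simp
  have "AE t in lebesgue_on {0<..}. G t = 0"
  proof (cases "q = \<infinity>")
    case True
    then show ?thesis using 0 esssup_AE[of G "lebesgue_on {0<..}"] by (simp add: Lq_norm_def)
  next
    case False
    then have "(\<integral>\<^sup>+ t. ennreal_powr (G t) (enn2real q) \<partial>(lebesgue_on {0<..})) = 0"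
      using 0 by (simp add: Lq_norm_def ennreal_powr_eq_0_iff)
    then show ?thesis using G by (simp add: nn_integral_0_iff_AE ennreal_powr_eq_0_iff)
  qed
  then have "AE t in lebesgue. t \<in> {0<..} \<longrightarrow> G t = 0" by (simp add: AE_restrict_space_iff)
  then have "AE t in lebesgue. t \<notin> {0<..<1::real}"
    by eventually_elim (metis greaterThanLessThan_iff greaterThan_iff less_irrefl pos)
  then have "emeasure lebesgue {0<..<1::real} = 0"
    by (subst (asm) AE_iff_measurable[of "{0<..<1}"]) auto
  then show False by simp
qed

text \<open>For finite \<open>q\<close> the power of the bound is a multiple of
  \<open>t powr (\<gamma> * q - 1)\<close>, integrable on \<open>(0, 1)\<close>; for infinite
  \<open>q\<close> the reciprocal is 0 and \<open>t powr \<gamma>\<close> is at most 1.\<close>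

lemma Lq_norm_finite:
  assumes G: "G \<in> borel_measurable (lebesgue_on {0<..})" and q: "0 < q" and \<gamma>: "0 < \<gamma>" and K: "0 \<le> K"
    and le: "\<And>t. 0 < t \<Longrightarrow> t < 1 \<Longrightarrow> G t \<le> ennreal (K * t powr (\<gamma> - enn2real (1 / q)))"
    and 0: "\<And>t. 1 \<le> t \<Longrightarrow> G t = 0"
  shows "Lq_norm q G < \<infinity>"
proof (cases "q = \<infinity>")
  case True
  have "G t \<le> ennreal K" if t: "0 < t" for t
  proof (cases "t < 1")
    case True
    have "t powr \<gamma> \<le> 1" using t True \<gamma> by (intro powr_le1) auto
    then have "K * t powr \<gamma> \<le> K" using K by (simp add: mult_left_le)
    then show ?thesis using le[OF t True] \<open>q = \<infinity>\<close> by (simp add: order_trans[OF _ ennreal_leI])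
  qed (use 0 in auto)
  then have "esssup (lebesgue_on {0<..}) G \<le> ennreal K"
    by (intro esssup_I G AE_I2) (auto simp: space_restrict_space)
  then show ?thesis using True by (simp add: Lq_norm_def le_less_trans[OF _ ennreal_less_top])
next
  case False
  define Q where "Q = enn2real q"
  have Q: "0 < Q" "enn2real (1 / q) = 1 / Q" using Lq_exponent[OF q False] by (auto simp: Q_def)
  have "(\<integral>\<^sup>+ t. ennreal_powr (G t) Q \<partial>(lebesgue_on {0<..})) =
      (\<integral>\<^sup>+ t. ennreal_powr (G t) Q * indicator {0<..} t \<partial>lebesgue)"
    by (simp add: nn_integral_restrict_space)
  also have "\<dots> \<le> (\<integral>\<^sup>+ t. ennreal (K powr Q) * ennreal (t powr (\<gamma> * Q - 1)) * indicator {0<..<1} t \<partial>lebesgue)"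
  proof (rule nn_integral_mono)
    fix t :: real
    show "ennreal_powr (G t) Q * indicator {0<..} t \<le>
        ennreal (K powr Q) * ennreal (t powr (\<gamma> * Q - 1)) * indicator {0<..<1} t"
    proof (cases "0 < t \<and> t < 1")
      case True
      have "ennreal_powr (G t) Q \<le> ennreal_powr (ennreal (K * t powr (\<gamma> - enn2real (1 / q)))) Q"
        using le True Q by (intro ennreal_powr_mono) auto
      also have "\<dots> = ennreal (K powr Q * t powr (\<gamma> * Q - 1))"
        using K Q by (simp add: ennreal_powr_ennreal powr_mult powr_powr algebra_simps)
      finally show ?thesis using True by (simp add: ennreal_mult)
    next
      case False
      then show ?thesis using 0[of t] by (auto simp: ennreal_powr_def)
    qed
  qed
  also have "\<dots> = (\<integral>\<^sup>+ t. ennreal (K powr Q) * ennreal (t powr (\<gamma> * Q - 1)) \<partial>(lebesgue_on {0<..<1}))"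
    by (simp add: nn_integral_restrict_space)
  also have "\<dots> = ennreal (K powr Q) * ennreal (1 / (\<gamma> * Q))"
  proof -
    have "(\<lambda>s. ennreal (s powr (\<gamma> * Q - 1))) \<in> borel_measurable (lebesgue_on {0<..<1})"
      by (rule borel_imp_lebesgue_on) measurable
    then show ?thesis using nn_integral_powr_Ioo[of "\<gamma> * Q" 1] \<gamma> Q by (simp add: nn_integral_cmult)
  qed
  also have "\<dots> < top" by (simp add: ennreal_mult_less_top)
  finally show ?thesis using False by (simp add: Lq_norm_def Q_def ennreal_powr_less_top)
qed

section \<open>Weights and comparison of the two functionals\<close>

lemma weight_measurable:
  "slowly_varying b \<Longrightarrow> weight p q b \<in> borel_measurable (lebesgue_on {0<..})"
proof -
  assume "slowly_varying b"
  then have [measurable]: "b \<in> borel_measurable (lebesgue_on {0<..})"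
    by (rule slowly_varying_measurable)
  have [measurable]: "(\<lambda>t. t powr (enn2real (1 / p) - enn2real (1 / q))) \<in> borel_measurable (lebesgue_on {0<..})"
    by (rule borel_imp_lebesgue_on) measurable
  show ?thesis unfolding weight_def by measurable
qed

lemma LK_integrand_measurable:
  assumes "slowly_varying b"
  shows "(\<lambda>t. weight p q b t * rearrangement R f t) \<in> borel_measurable (lebesgue_on {0<..})"
    "(\<lambda>t. weight p q b t * maximal_rearrangement R f t) \<in> borel_measurable (lebesgue_on {0<..})"
proof -
  note [measurable] = weight_measurable[OF assms]
    borel_imp_lebesgue_on[OF borel_measurable_antimono_ennreal[OF antimono_rearrangement]]
    maximal_rearrangement_measurable
  show "(\<lambda>t. weight p q b t * rearrangement R f t) \<in> borel_measurable (lebesgue_on {0<..})"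
    "(\<lambda>t. weight p q b t * maximal_rearrangement R f t) \<in> borel_measurable (lebesgue_on {0<..})"
    by measurable
qed

lemma LK_norm_le_LK_max_norm:
  "slowly_varying b \<Longrightarrow> LK_norm R p q b f \<le> LK_max_norm R p q b f"
  unfolding LK_norm_def LK_max_norm_def
  by (intro Lq_norm_mono LK_integrand_measurable mult_left_mono rearrangement_le_maximal) auto

text \<open>Write \<open>t\<close> as \<open>(1 / d) * (t * d)\<close>: the power part of the weight
  scales exactly, and slow variation of \<open>b\<close> costs
  \<open>d powr (- \<epsilon>)\<close>.\<close>

lemma weight_dilation:
  assumes b: "slowly_varying b" and e: "0 < \<epsilon>"
  obtains K where "0 < K" "\<And>d t. 0 < d \<Longrightarrow> d \<le> 1 \<Longrightarrow> 0 < t \<Longrightarrow>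
    weight p q b t \<le> ennreal (K * d powr (enn2real (1 / q) - enn2real (1 / p) - \<epsilon>)) * weight p q b (t * d)"
proof -
  obtain K where K: "0 < K" and bK: "\<And>l u. 1 \<le> l \<Longrightarrow> 0 < u \<Longrightarrow> b (l * u) \<le> K * l powr \<epsilon> * b u"
    using slowly_varying_dilation[OF b e] by metis
  show ?thesis
  proof (rule that[OF K])
    fix d t :: real assume d: "0 < d" "d \<le> 1" and t: "0 < t"
    define a where "a = enn2real (1 / p) - enn2real (1 / q)"
    have bp: "0 < b (t * d)" using b d t by (simp add: slowly_varying_pos)
    have "t powr a * b t = t powr a * b (1 / d * (t * d))" using d by simp
    also have "\<dots> \<le> t powr a * (K * (1 / d) powr \<epsilon> * b (t * d))"
      using d t by (intro mult_left_mono bK) auto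
    also have "\<dots> = K * d powr (- a - \<epsilon>) * ((t * d) powr a * b (t * d))"
    proof -
      have 1: "t powr a = d powr (- a) * (t * d) powr a"
        using d t by (simp add: powr_mult powr_minus)
      have 2: "(1 / d) powr \<epsilon> = d powr (- \<epsilon>)"
        using d by (simp add: powr_divide powr_minus_divide)
      have 3: "d powr (- a - \<epsilon>) = d powr (- a) * d powr (- \<epsilon>)"
        by (simp flip: powr_add)
      show ?thesis unfolding 1 2 3 by (simp only: mult_ac)
    qed
    finally have "ennreal (t powr a * b t) \<le> ennreal (K * d powr (- a - \<epsilon>) * ((t * d) powr a * b (t * d)))"
      by (rule ennreal_leI)
    also have "\<dots> = ennreal (K * d powr (- a - \<epsilon>)) * ennreal ((t * d) powr a * b (t * d))"
      using K bp by (intro ennreal_mult) auto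
    finally show "weight p q b t \<le>
        ennreal (K * d powr (enn2real (1 / q) - enn2real (1 / p) - \<epsilon>)) * weight p q b (t * d)"
      by (simp add: weight_def a_def)
  qed
qed

lemma LK_max_norm_le_LK_norm:
  fixes p q :: ennreal
  assumes b: "slowly_varying b" and q: "0 < q" and p: "enn2real (1 / p) < 1"
  obtains C where "0 < C" "\<And>f. LK_max_norm R p q b f \<le> ennreal C * LK_norm R p q b f"
proof -
  define a where "a = enn2real (1 / p)"
  define r where "r = enn2real (1 / q)"
  \<comment> \<open>This makes \<open>\<alpha>\<close> equal to \<open>(1 + a) / 2\<close>, below 1
    but above \<open>a\<close> by two copies of \<open>\<epsilon>\<close>. Dilating the weight
    consumes one; the other remains as the decay in
    \<open>\<alpha> + (r - a - \<epsilon>) = \<epsilon> + r\<close>, the exponent that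
    \<open>Lq_norm_dyadic_SUP\<close> requires.\<close>
  define \<epsilon> where "\<epsilon> = (1 - a) / 4"
  define \<alpha> where "\<alpha> = a + 2 * \<epsilon>"
  have a: "0 \<le> a" "a < 1" using p by (auto simp: a_def)
  have e: "0 < \<epsilon>" "0 \<le> \<alpha>" "\<alpha> < 1" using a by (auto simp: \<epsilon>_def \<alpha>_def field_simps)
  obtain K where K: "0 < K" and w: "\<And>d t. 0 < d \<Longrightarrow> d \<le> 1 \<Longrightarrow> 0 < t \<Longrightarrow>
      weight p q b t \<le> ennreal (K * d powr (r - a - \<epsilon>)) * weight p q b (t * d)"
    using weight_dilation[OF b e(1), of p q] unfolding a_def r_def by metis
  define K' where "K' = 2 powr \<alpha> / (1 - \<alpha>) * K"
  have K': "0 < K'" using K e by (simp add: K'_def)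
  obtain C where C: "0 < C" and *: "\<forall>G \<in> borel_measurable (lebesgue_on {0<..}).
      \<forall>H \<in> borel_measurable (lebesgue_on {0<..}).
      (\<forall>t>0. H t \<le> ennreal K' *
        (SUP m::nat. ennreal (((1 / 2) ^ m) powr (\<epsilon> + r)) * G (t * (1 / 2) ^ m))) \<longrightarrow>
      Lq_norm q H \<le> ennreal C * Lq_norm q G"
    using Lq_norm_dyadic_SUP[OF q e(1) K', folded r_def] by blast
  show ?thesis
  proof (rule that[OF C])
    fix f :: "'a \<Rightarrow> ext_complex"
    let ?G = "\<lambda>t. weight p q b t * rearrangement R f t"
    show "LK_max_norm R p q b f \<le> ennreal C * LK_norm R p q b f"
      unfolding LK_max_norm_def LK_norm_def
    proof (rule *[rule_format, OF LK_integrand_measurable[OF b]])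
      fix t :: real assume t: "0 < t"
      have "weight p q b t * maximal_rearrangement R f t \<le> weight p q b t *
          (ennreal (2 powr \<alpha> / (1 - \<alpha>)) *
            (SUP m::nat. ennreal (((1 / 2) ^ m) powr \<alpha>) * rearrangement R f (t * (1 / 2) ^ m)))"
        unfolding maximal_rearrangement_def
        by (intro mult_left_mono average_le_dyadic_SUP antimono_rearrangement e t) auto
      also have "\<dots> = ennreal (2 powr \<alpha> / (1 - \<alpha>)) *
            (SUP m::nat. weight p q b t * (ennreal (((1 / 2) ^ m) powr \<alpha>) * rearrangement R f (t * (1 / 2) ^ m)))"
        by (simp add: SUP_mult_left_ennreal[symmetric] ac_simps)
      also have "\<dots> \<le> ennreal (2 powr \<alpha> / (1 - \<alpha>)) *
            (SUP m::nat. ennreal K * (ennreal (((1 / 2) ^ m) powr (\<epsilon> + r)) * ?G (t * (1 / 2) ^ m)))"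
      proof (intro mult_left_mono SUP_mono')
        fix m :: nat
        define d where "d = (1 / 2 :: real) ^ m"
        have d: "0 < d" "d \<le> 1" by (auto simp: d_def power_le_one)
        have "weight p q b t * (ennreal (d powr \<alpha>) * rearrangement R f (t * d)) \<le>
            ennreal (K * d powr (r - a - \<epsilon>)) * weight p q b (t * d) *
            (ennreal (d powr \<alpha>) * rearrangement R f (t * d))"
          using w[OF d t] by (intro mult_right_mono) auto
        also have "\<dots> = (ennreal (K * d powr (r - a - \<epsilon>)) * ennreal (d powr \<alpha>)) * ?G (t * d)"
          by (simp add: ac_simps)
        also have "ennreal (K * d powr (r - a - \<epsilon>)) * ennreal (d powr \<alpha>) =
            ennreal K * ennreal (d powr (\<epsilon> + r))"
          using K by (simp add: ennreal_mult[symmetric] powr_add[symmetric] \<alpha>_def mult.assoc add.commute)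
        finally show "weight p q b t * (ennreal (((1 / 2) ^ m) powr \<alpha>) * rearrangement R f (t * (1 / 2) ^ m))
            \<le> ennreal K * (ennreal (((1 / 2) ^ m) powr (\<epsilon> + r)) * ?G (t * (1 / 2) ^ m))"
          unfolding d_def by (simp add: mult.assoc)
      qed simp
      also have "\<dots> = ennreal K' *
            (SUP m::nat. ennreal (((1 / 2) ^ m) powr (\<epsilon> + r)) * ?G (t * (1 / 2) ^ m))"
        using K e unfolding K'_def SUP_mult_left_ennreal[symmetric]
        by (subst ennreal_mult) (auto simp: mult.assoc)
      finally show "weight p q b t * maximal_rearrangement R f t \<le> ennreal K' *
            (SUP m::nat. ennreal (((1 / 2) ^ m) powr (\<epsilon> + r)) * ?G (t * (1 / 2) ^ m))" .
    qed
  qed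
qed

lemma LK_max_norm_blowup:
  fixes p q :: ennreal
  assumes R: "sigma_finite_measure R" "nonatomic R" "emeasure R (space R) = \<infinity>"
    and b: "slowly_varying b" and q: "0 < q" and p: "1 \<le> enn2real (1 / p)"
    and e: "0 < \<epsilon>" "\<epsilon> < 1"
  obtains f where "f \<in> measurable_functions R" "0 < LK_norm R p q b f" "LK_norm R p q b f < \<infinity>"
    "ennreal (1 / (2 * \<epsilon>)) * LK_norm R p q b f \<le> LK_max_norm R p q b f"
proof -
  \<comment> \<open>Then \<open>c ^ k\<close> is the value of \<open>t powr (\<epsilon> - 1)\<close>
    at the upper end of the \<open>k\<close>-th dyadic interval.\<close>
  define c where "c = (2::real) powr (1 - \<epsilon>)"
  have "1 < c" using e by (simp add: c_def)
  then obtain f where fm: "f \<in> measurable_functions R" and f0: "\<And>t. 1 \<le> t \<Longrightarrow> rearrangement R f t = 0"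
    and f1: "\<And>k t. (1 / 2) ^ Suc k \<le> t \<Longrightarrow> t < (1 / 2) ^ k \<Longrightarrow> rearrangement R f t = ennreal (c ^ k)"
    using ex_dyadic_rearrangement[OF R] by metis
  have cmp: "rearrangement R f t \<le> ennreal (t powr (\<epsilon> - 1))"
      "ennreal (t powr (\<epsilon> - 1) / 2) \<le> rearrangement R f t"
    if t: "0 < t" "t < 1" for t
  proof -
    obtain k where k: "(1 / 2) ^ Suc k \<le> t" "t < (1 / 2) ^ k"
      using ex_dyadic_bracket[OF t] by auto
    define d where "d = (1 / 2 :: real) ^ k"
    have d: "0 < d" "d / 2 \<le> t" "t < d" using k by (auto simp: d_def)
    have "c ^ k = (2 powr real k) powr (1 - \<epsilon>)"
      unfolding c_def by (simp add: powr_realpow[symmetric] powr_powr mult.commute)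
    also have "2 powr real k = 1 / d" by (simp add: d_def powr_realpow power_divide)
    also have "(1 / d) powr (1 - \<epsilon>) = d powr (\<epsilon> - 1)"
      using d by (simp add: powr_divide powr_diff)
    finally have ck: "c ^ k = d powr (\<epsilon> - 1)" .
    have "d powr (\<epsilon> - 1) \<le> t powr (\<epsilon> - 1)" using d t e by (intro powr_mono2') auto
    then show "rearrangement R f t \<le> ennreal (t powr (\<epsilon> - 1))"
      using f1[OF k] ck by (simp add: ennreal_leI)
    \<comment> \<open>Passing to the lower end costs \<open>2 powr (1 - \<epsilon>)\<close>, which
      is at most 2. This loss is the 2 in the factor \<open>1 / (2 * \<epsilon>)\<close>;
      integrating the power supplies the \<open>\<epsilon>\<close>.\<close>
    have "t powr (\<epsilon> - 1) \<le> (d / 2) powr (\<epsilon> - 1)" using d t e by (intro powr_mono2') auto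
    also have "\<dots> = d powr (\<epsilon> - 1) * 2 powr (1 - \<epsilon>)" using d by (simp add: powr_divide powr_diff)
    also have "\<dots> \<le> d powr (\<epsilon> - 1) * 2"
      using e powr_mono[of "1 - \<epsilon>" 1 2] by (intro mult_left_mono) auto
    finally show "ennreal (t powr (\<epsilon> - 1) / 2) \<le> rearrangement R f t"
      using f1[OF k] ck by (simp add: ennreal_leI)
  qed
  have avg: "ennreal (1 / (2 * \<epsilon>)) * rearrangement R f t \<le> maximal_rearrangement R f t" if t: "0 < t" for t
  proof (cases "t < 1")
    case True
    have "ennreal (t powr \<epsilon> / (2 * \<epsilon>)) = (\<integral>\<^sup>+ s. ennreal (s powr (\<epsilon> - 1)) * ennreal (1 / 2) \<partial>(lebesgue_on {0<..<t}))"
    proof -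
      have "(\<lambda>s. ennreal (s powr (\<epsilon> - 1))) \<in> borel_measurable (lebesgue_on {0<..<t})"
        by (rule borel_imp_lebesgue_on) measurable
      then show ?thesis using e nn_integral_powr_Ioo[of \<epsilon> t] t
        by (subst nn_integral_multc) (simp_all add: ennreal_mult[symmetric] del: ennreal_half)
    qed
    also have "\<dots> \<le> (\<integral>\<^sup>+ s. rearrangement R f s \<partial>(lebesgue_on {0<..<t}))"
    proof (rule nn_integral_mono)
      fix s assume "s \<in> space (lebesgue_on {0<..<t})"
      then have s: "0 < s" "s < 1" using True by (auto simp: space_restrict_space)
      from cmp(2)[OF s] show "ennreal (s powr (\<epsilon> - 1)) * ennreal (1 / 2) \<le> rearrangement R f s"
        by (subst ennreal_mult[symmetric]) auto
    qed
    finally have "ennreal (t powr \<epsilon> / (2 * \<epsilon>)) / ennreal t \<le> maximal_rearrangement R f t"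
      unfolding maximal_rearrangement_def by (rule divide_right_mono_ennreal)
    also have "ennreal (t powr \<epsilon> / (2 * \<epsilon>)) / ennreal t = ennreal (1 / (2 * \<epsilon>)) * ennreal (t powr (\<epsilon> - 1))"
      using t e by (simp add: divide_ennreal ennreal_mult[symmetric] powr_diff field_simps)
    finally show ?thesis
      using cmp(1)[OF t True] by (meson mult_left_mono order_trans zero_le)
  qed (use f0 in auto)
  let ?G = "\<lambda>t. weight p q b t * rearrangement R f t"
  note Gm = LK_integrand_measurable(1)[OF b, of p q R f]
  show ?thesis
  proof (rule that[OF fm])
    show "0 < LK_norm R p q b f"
      unfolding LK_norm_def
    proof (rule Lq_norm_pos[OF Gm q])
      fix t :: real assume t: "0 < t" "t < 1"
      have "0 < ennreal (t powr (\<epsilon> - 1) / 2)" using t by simp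
      also have "\<dots> \<le> rearrangement R f t" by (rule cmp(2)[OF t])
      finally have "0 < rearrangement R f t" .
      moreover have "0 < weight p q b t"
        using t slowly_varying_pos[OF b t(1)] by (simp add: weight_def)
      ultimately show "0 < ?G t" by (simp add: ennreal_zero_less_mult_iff)
    qed
    \<comment> \<open>Half of \<open>\<epsilon>\<close> absorbs \<open>b\<close>; the other half
      keeps the norm finite at 0.\<close>
    obtain K where K: "0 < K" and bK: "\<And>t. 0 < t \<Longrightarrow> t < 1 \<Longrightarrow> t powr (\<epsilon> / 2) * b t \<le> K"
      using slowly_varying_bounded_near_0[OF b, of "\<epsilon> / 2"] e by auto
    show "LK_norm R p q b f < \<infinity>"
      unfolding LK_norm_def
    proof (rule Lq_norm_finite[OF Gm q, of "\<epsilon> / 2" K])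
      fix t :: real assume t: "0 < t" "t < 1"
      define a where "a = enn2real (1 / p)"
      define r where "r = enn2real (1 / q)"
      have bp: "0 < b t" using b t slowly_varying_pos by blast
      have "?G t \<le> weight p q b t * ennreal (t powr (\<epsilon> - 1))"
        by (intro mult_left_mono cmp t) auto
      also have "\<dots> = ennreal (t powr (a - r) * b t * t powr (\<epsilon> - 1))"
        using bp by (simp add: weight_def a_def r_def ennreal_mult[symmetric])
      also have "\<dots> \<le> ennreal (K * t powr (\<epsilon> / 2 - r))"
      proof (rule ennreal_leI)
        \<comment> \<open>The factor \<open>t powr (a - 1)\<close> is isolated because
          \<open>1 \<le> a\<close> bounds it by 1 on \<open>(0, 1)\<close>; this is where
          \<open>p \<le> 1\<close> enters.\<close>
        have "t powr (a - r) * b t * t powr (\<epsilon> - 1) = t powr (a - 1) * t powr (\<epsilon> / 2 - r) * (t powr (\<epsilon> / 2) * b t)"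
          using t by (simp add: powr_add[symmetric] algebra_simps)
        also have "\<dots> \<le> 1 * t powr (\<epsilon> / 2 - r) * K"
          using t bp p bK[OF t] by (intro mult_mono powr_le1) (auto simp: a_def)
        finally show "t powr (a - r) * b t * t powr (\<epsilon> - 1) \<le> K * t powr (\<epsilon> / 2 - r)"
          by (simp add: mult.commute)
      qed
      finally show "?G t \<le> ennreal (K * t powr (\<epsilon> / 2 - enn2real (1 / q)))" by (simp add: r_def)
    qed (use e K f0 in auto)
    have "ennreal (1 / (2 * \<epsilon>)) * LK_norm R p q b f \<le> Lq_norm q (\<lambda>t. ennreal (1 / (2 * \<epsilon>)) * ?G t)"
      unfolding LK_norm_def by (rule Lq_norm_cmult_ge[OF Gm q]) (use e in auto)
    also have "\<dots> \<le> LK_max_norm R p q b f"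
      unfolding LK_max_norm_def
    proof (rule Lq_norm_mono)
      show "(\<lambda>t. ennreal (1 / (2 * \<epsilon>)) * ?G t) \<in> borel_measurable (lebesgue_on {0<..})"
        using Gm by measurable
      fix t :: real assume "0 < t"
      from mult_left_mono[OF avg[OF this], of "weight p q b t"]
      show "ennreal (1 / (2 * \<epsilon>)) * ?G t \<le> weight p q b t * maximal_rearrangement R f t"
        by (simp add: ac_simps)
    qed
    finally show "ennreal (1 / (2 * \<epsilon>)) * LK_norm R p q b f \<le> LK_max_norm R p q b f" .
  qed
qed

text \<open>Positivity of \<open>p\<close> matters: \<open>1 / 0\<close> is infinite and
  \<open>enn2real\<close> sends it to 0. For infinite \<open>p\<close> both sides hold.\<close>

lemma one_less_iff_inverse_less_one:
  fixes p :: ennreal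
  assumes "0 < p"
  shows "1 < p \<longleftrightarrow> enn2real (1 / p) < 1"
proof (cases p)
  case (real x)
  with assms have x: "0 < x" by simp
  then have "1 / p = ennreal (1 / x)" using real divide_ennreal[of 1 x] by simp
  moreover have "1 < p \<longleftrightarrow> 1 < x" using real ennreal_less_iff[of 1 x] by simp
  ultimately show ?thesis using x by simp
qed simp

theorem corollary3p22:
  fixes R :: "'a measure" and p q :: ennreal and b :: "real \<Rightarrow> real"
  assumes "sigma_finite_measure R"
    and "nonatomic R"
    and "emeasure R (space R) = \<infinity>"
    and "0 < p" and "0 < q"
    and "slowly_varying b"
  shows "(LK_max_space R p q b = LK_space R p q b \<and>
          equivalent_on (measurable_functions R) (LK_max_norm R p q b) (LK_norm R p q b))
         \<longleftrightarrow> 1 < p"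
proof
  assume "1 < p"
  then have "enn2real (1 / p) < 1" using one_less_iff_inverse_less_one[OF assms(4)] by simp
  then obtain C where C: "0 < C" and le: "\<And>f. LK_max_norm R p q b f \<le> ennreal C * LK_norm R p q b f"
    using LK_max_norm_le_LK_norm[OF assms(6,5)] by metis
  have ge: "LK_norm R p q b f \<le> LK_max_norm R p q b f" for f
    by (rule LK_norm_le_LK_max_norm[OF assms(6)])
  have "LK_max_norm R p q b f < \<infinity> \<longleftrightarrow> LK_norm R p q b f < \<infinity>" for f
    using le[of f] ge[of f] by (auto simp: ennreal_mult_less_top intro: le_less_trans)
  then have "LK_max_space R p q b = LK_space R p q b"
    by (simp add: LK_max_space_def LK_space_def finite_space_def)
  moreover have "equivalent_on (measurable_functions R) (LK_max_norm R p q b) (LK_norm R p q b)"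
    unfolding equivalent_on_def
  proof (intro exI[of _ "max 1 C"] conjI ballI)
    fix f :: "'a \<Rightarrow> ext_complex"
    have "LK_max_norm R p q b f \<le> ennreal C * LK_norm R p q b f" by (rule le)
    also have "\<dots> \<le> ennreal (max 1 C) * LK_norm R p q b f"
      by (intro mult_right_mono ennreal_leI) auto
    finally show "LK_max_norm R p q b f \<le> ennreal (max 1 C) * LK_norm R p q b f" .
    have "LK_norm R p q b f \<le> 1 * LK_max_norm R p q b f" using ge by simp
    also have "\<dots> \<le> ennreal (max 1 C) * LK_max_norm R p q b f"
      by (intro mult_right_mono) (auto simp flip: ennreal_1 intro: ennreal_leI)
    finally show "LK_norm R p q b f \<le> ennreal (max 1 C) * LK_max_norm R p q b f" .
  qed simp
  ultimately show "LK_max_space R p q b = LK_space R p q b \<and>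
      equivalent_on (measurable_functions R) (LK_max_norm R p q b) (LK_norm R p q b)" ..
next
  assume *: "LK_max_space R p q b = LK_space R p q b \<and>
      equivalent_on (measurable_functions R) (LK_max_norm R p q b) (LK_norm R p q b)"
  then obtain C where C: "0 < C" and
    le: "\<And>f. f \<in> measurable_functions R \<Longrightarrow> LK_max_norm R p q b f \<le> ennreal C * LK_norm R p q b f"
    unfolding equivalent_on_def by blast
  show "1 < p"
  proof (rule ccontr)
    assume "\<not> 1 < p"
    then have p: "1 \<le> enn2real (1 / p)" using one_less_iff_inverse_less_one[OF assms(4)] by simp
    \<comment> \<open>Chosen so that the blow-up factor is \<open>C + 1\<close>, just beyond the
      assumed constant.\<close>
    define \<epsilon> where "\<epsilon> = 1 / (2 * (C + 1))"
    have e: "0 < \<epsilon>" "\<epsilon> < 1" "1 / (2 * \<epsilon>) = C + 1" using C by (auto simp: \<epsilon>_def)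
    obtain f where f: "f \<in> measurable_functions R" "0 < LK_norm R p q b f" "LK_norm R p q b f < \<infinity>"
      "ennreal (1 / (2 * \<epsilon>)) * LK_norm R p q b f \<le> LK_max_norm R p q b f"
      using LK_max_norm_blowup[OF assms(1-3,6,5) p e(1,2)] by metis
    have "ennreal (C + 1) * LK_norm R p q b f \<le> ennreal C * LK_norm R p q b f"
      using f(4) le[OF f(1)] e(3) by simp
    then have "LK_norm R p q b f * ennreal (C + 1) \<le> LK_norm R p q b f * ennreal C"
      by (simp add: mult.commute)
    \<comment> \<open>Cancelling the norm is legitimate because it is neither 0 nor
      infinite.\<close>
    then have "ennreal (C + 1) \<le> ennreal C"
      using f(2,3) by (subst (asm) ennreal_mult_le_mult_iff) auto
    then show False using C by simp
  qed
qed

end
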